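(* Consider the system $$\dot x = f_1(x,u)+f_2(x,u)\,\mathcal G(\eta),\qquad y=\begin{bmatrix} y_1\\ x\end{bmatrix}=\begin{bmatrix} h_1(x,u)+h_2(x,u)\theta_2+h_3(x,u)e^{h_4(x)\theta_1}\\ x\end{bmatrix},$$ with state $x(t)\in\mathbb R^n$, output $y(t)\in\mathbb R^{n+1}$ and control $u(t)\in\mathbb R^m$, where $f_1,f_2,h_1,h_2,h_3,h_4$ are known functions, $\mathcal G:\mathbb R^{n_\eta}\to\mathbb R^{p_\eta}$, $p_\eta>n_\eta$, is a known mapping, and $\theta:=\mathrm{col}(\theta_1,\theta_2,\eta)\in\mathbb R^{\ell_I}$, $\ell_I:=2+n_\eta$, is the constant vector of unknown parameters, with $\theta_1,\theta_2\in\mathbb R$ and $\eta\in\mathbb R^{n_\eta}$. Assume: (i) the scalar function $h_3$ satisfies $|h_3|>0$; (ii) there exist a matrix $T_{\mathcal G}\in\mathbb R^{n_\eta\times p_\eta}$ and a constant $\rho_{\mathcal G}>0$ such that $T_{\mathcal G}\nabla\mathcal G(\eta)+[\nabla\mathcal G(\eta)]^\top T_{\mathcal G}^\top\ge\rho_{\mathcal G}I_{n_\eta}$. Then there exist measurable scalar signals $Y_I(x,u,y)$ and $\phi_{I,i}(x,u,y)$, $i=1,\dots,s_I$, $s_I:=3+2p_\eta$, such that, with $\phi_I:=\mathrm{col}(\phi_{I,1},\dots,\phi_{I,s_I})$, the following nonlinearly parameterized regression equation holds: $$Y_I(x,u,y)=\phi_I^\top(x,u,y)\,\mathcal W_I(\theta),$$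 where $\mathcal W_I:\mathbb R^{\ell_I}\to\mathbb R^{s_I}$ is the mapping $$\mathcal W_I(\theta):=\begin{bmatrix}\theta_1&\theta_2&\theta_1\theta_2&\theta_1\mathcal G^\top(\eta)&\theta_1\theta_2\mathcal G^\top(\eta)\end{bmatrix}^\top.$$
   Context: All functions and mappings are assumed smooth, all dynamical systems are assumed forward complete, and the state trajectories of the system are assumed bounded. $I_q$ is the $q\times q$ identity matrix and $\nabla\mathcal G(\eta)=\partial\mathcal G/\partial\eta(\eta)$ is the Jacobian of $\mathcal G$. Dimensions: $f_1(x,u)\in\mathbb R^n$, $f_2(x,u)\in\mathbb R^{n\times p_\eta}$, and $h_1,h_2,h_3,h_4$ are scalar. Matrix inequalities are in the sense of symmetric matrices. The signals $u$ and $y$ (hence $x$) are measured; $\theta$ is unknown. A signal, written $Y(x,u,y)$ or $\phi_i(x,u,y)$, is called measurable if it can be computed on-line (causally) from the measured signals $x,u,y$ and the known functions, without knowledge of the parameters $\theta$ and without differentiating measured signals (for example, via stable proper linear time-invariant filters). The regression equation is an identity between signals of time along the trajectories of the system. *)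

theory Defs
  imports "HOL-Analysis.Analysis"
begin

primrec Ck :: "nat \<Rightarrow> ('a::euclidean_space \<Rightarrow> 'b::real_normed_vector) \<Rightarrow> bool" where
  "Ck 0 f \<longleftrightarrow> continuous_on UNIV f"
| "Ck (Suc k) f \<longleftrightarrow>
     (\<exists>f'. (\<forall>x. (f has_derivative f' x) (at x)) \<and> (\<forall>v. Ck k (\<lambda>x. f' x v)))"

definition smooth :: "('a::euclidean_space \<Rightarrow> 'b::real_normed_vector) \<Rightarrow> bool" where
  "smooth f \<longleftrightarrow> (\<forall>k. Ck k f)"

definition sym_matrix_ge :: "real^'q^'q \<Rightarrow> real^'q^'q \<Rightarrow> bool" where
  "sym_matrix_ge A B \<longleftrightarrow>
     transpose A = A \<and> transpose B = B \<and> (\<forall>v. v \<bullet> (B *v v) \<le> v \<bullet> (A *v v))"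

text \<open>
  A signal computed on-line from a measured signal \<open>w\<close> is an operator \<open>S\<close>, with \<open>S w t\<close> its value
  at time \<open>t\<close>.  Causality means that \<open>S w t\<close> only involves \<open>w\<close> on \<open>[0, t]\<close>; that no
  differentiation of \<open>w\<close> is involved is expressed by continuity with respect to the supremum norm
  on \<open>[0, t]\<close>, which differentiation lacks
  (lemma \<open>not_online_measurable_derivative\<close>), whereas static maps and low-pass filters
  have it.  Independence of unknown parameters is not part of the
  definition: it results from choosing the operator before the parameters.
\<close>

definition causal :: "((real \<Rightarrow> 'w::real_normed_vector) \<Rightarrow> real \<Rightarrow> real) \<Rightarrow> bool" where
  "causal S \<longleftrightarrow>
     (\<forall>t\<ge>0. \<forall>w w'. continuous_on {0..} w \<longrightarrow> continuous_on {0..} w' \<longrightarrow>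
        (\<forall>s\<in>{0..t}. w s = w' s) \<longrightarrow> S w t = S w' t)"

definition differentiation_free ::
  "((real \<Rightarrow> 'w::real_normed_vector) \<Rightarrow> real \<Rightarrow> real) \<Rightarrow> bool" where
  "differentiation_free S \<longleftrightarrow>
     (\<forall>t\<ge>0. \<forall>W w. (\<forall>k::nat. continuous_on {0..} (W k)) \<longrightarrow> continuous_on {0..} w \<longrightarrow>
        uniform_limit {0..t} W w sequentially \<longrightarrow> (\<lambda>k. S (W k) t) \<longlonglongrightarrow> S w t)"

definition online_measurable ::
  "((real \<Rightarrow> 'w::real_normed_vector) \<Rightarrow> real \<Rightarrow> real) \<Rightarrow> bool" where
  "online_measurable S \<longleftrightarrow> causal S \<and> differentiation_free S"

lemma online_measurable_static:
  fixes g :: "'w::real_normed_vector \<Rightarrow> real"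
  assumes "continuous_on UNIV g"
  shows "online_measurable (\<lambda>w t. g (w t))"
  unfolding online_measurable_def causal_def differentiation_free_def
proof (intro conjI allI impI)
  fix t :: real and W :: "nat \<Rightarrow> real \<Rightarrow> 'w" and w
  assume "0 \<le> t" "uniform_limit {0..t} W w sequentially"
  then have "(\<lambda>k. W k t) \<longlonglongrightarrow> w t"
    by (intro tendsto_uniform_limitI[where S = "{0..t}"]) auto
  then show "(\<lambda>k. g (W k t)) \<longlonglongrightarrow> g (w t)"
    using assms continuous_on_tendsto_compose[of UNIV g] by auto
qed auto

lemma online_measurable_low_pass:
  fixes g :: "'w::euclidean_space \<Rightarrow> real"
  assumes g: "continuous_on UNIV g"
  shows "online_measurable (\<lambda>w t. integral {0..t} (\<lambda>s. exp (- a * (t - s)) * g (w s)))"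
  unfolding online_measurable_def causal_def differentiation_free_def
proof (intro conjI allI impI)
  fix t :: real and w w' :: "real \<Rightarrow> 'w"
  assume "\<forall>s\<in>{0..t}. w s = w' s"
  then show "integral {0..t} (\<lambda>s. exp (- a * (t - s)) * g (w s)) =
             integral {0..t} (\<lambda>s. exp (- a * (t - s)) * g (w' s))"
    by (intro integral_cong) auto
next
  fix t :: real and W :: "nat \<Rightarrow> real \<Rightarrow> 'w" and w
  assume t: "0 \<le> t" and W: "\<forall>k. continuous_on {0..} (W k)" and w: "continuous_on {0..} w"
    and lim: "uniform_limit {0..t} W w sequentially"
  have wt: "continuous_on {0..t} w" and Wt: "continuous_on {0..t} (W k)" for k
    using w W by (auto intro: continuous_on_subset)
  have "bounded (w ` {0..t})"
    by (intro compact_imp_bounded compact_continuous_image wt) auto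
  then obtain r where r: "\<And>s. s \<in> {0..t} \<Longrightarrow> norm (w s) \<le> r"
    unfolding bounded_iff by blast
  define K where "K = cball (0::'w) (r + 1)"
  have ev: "\<forall>\<^sub>F k in sequentially. \<forall>s\<in>{0..t}. W k s \<in> K"
    using uniform_limitD[OF lim, of 1, simplified]
  proof eventually_elim
    case (elim k)
    show ?case
    proof
      fix s assume s: "s \<in> {0..t}"
      have "norm (W k s) \<le> norm (w s) + norm (W k s - w s)"
        by (metis add.commute diff_add_cancel norm_triangle_ineq)
      with elim s r[OF s] show "W k s \<in> K"
        unfolding K_def by (fastforce simp: dist_norm)
    qed
  qed
  have "uniformly_continuous_on K g"
    unfolding K_def
    by (intro compact_uniformly_continuous continuous_on_subset[OF g]) auto
  then have gl: "uniform_limit {0..t} (\<lambda>k s. g (W k s)) (\<lambda>s. g (w s)) sequentially"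
    by (rule uniform_limit_compose_uniformly_continuous_on[OF lim])
       (use ev in \<open>auto simp: K_def\<close>)
  have "uniform_limit {0..t} (\<lambda>k s. exp (- a * (t - s)) * g (W k s))
          (\<lambda>s. exp (- a * (t - s)) * g (w s)) sequentially"
  proof (intro bounded_bilinear.bounded_uniform_limit[OF bounded_bilinear_mult]
      uniform_limit_const gl compact_imp_bounded compact_continuous_image)
    show "continuous_on {0..t} (\<lambda>s. g (w s))"
      by (rule continuous_on_compose2[OF g wt]) auto
  qed (auto intro!: continuous_intros)
  moreover have "continuous_on {0..t} (\<lambda>s. exp (- a * (t - s)) * g (W k s))" for k
    by (intro continuous_intros continuous_on_compose2[OF g Wt]) auto
  ultimately obtain I J where IJ:
    "\<And>k. ((\<lambda>s. exp (- a * (t - s)) * g (W k s)) has_integral I k) {0..t}"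
    "((\<lambda>s. exp (- a * (t - s)) * g (w s)) has_integral J) {0..t}" "I \<longlonglongrightarrow> J"
    by (rule uniform_limit_integral) auto
  then show "(\<lambda>k. integral {0..t} (\<lambda>s. exp (- a * (t - s)) * g (W k s)))
      \<longlonglongrightarrow> integral {0..t} (\<lambda>s. exp (- a * (t - s)) * g (w s))"
    using IJ(3) by (simp only: integral_unique[OF IJ(1)] integral_unique[OF IJ(2)])
qed

lemma not_online_measurable_derivative:
  "\<not> online_measurable (\<lambda>(w :: real \<Rightarrow> real) t. vector_derivative w (at t within {0..t}))"
proof
  let ?W = "\<lambda>(k::nat) s. sin (real (Suc k) * (s - 1)) / real (Suc k)"
  assume "online_measurable (\<lambda>(w :: real \<Rightarrow> real) t. vector_derivative w (at t within {0..t}))"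
  moreover have "uniform_limit {0..1} ?W (\<lambda>_. 0) sequentially"
  proof (rule uniform_limitI)
    fix e :: real assume "0 < e"
    then have "\<forall>\<^sub>F k in sequentially. inverse (real (Suc k)) < e"
      using LIMSEQ_inverse_real_of_nat order_tendstoD(2) by blast
    then show "\<forall>\<^sub>F k in sequentially. \<forall>s\<in>{0..1}. dist (?W k s) 0 < e"
    proof eventually_elim
      case (elim k)
      show ?case
      proof
        fix s :: real
        have "\<bar>?W k s\<bar> \<le> 1 / real (Suc k)"
          unfolding abs_divide by (intro frac_le) auto
        with elim show "dist (?W k s) 0 < e" by (simp add: inverse_eq_divide)
      qed
    qed
  qed
  moreover have "continuous_on {0..} (?W k)" for k
    by (intro continuous_intros) auto
  ultimately have "(\<lambda>k. vector_derivative (?W k) (at 1 within {0..1}))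
      \<longlonglongrightarrow> vector_derivative (\<lambda>_. 0::real) (at 1 within {0..1})"
    unfolding online_measurable_def differentiation_free_def
    by (auto dest!: spec[of _ "1::real"])
  moreover have "vector_derivative (?W k) (at 1 within {0..1}) = 1" for k
    by (rule vector_derivative_within_closed_interval)
       (auto simp flip: has_real_derivative_iff_has_vector_derivative
             intro!: derivative_eq_intros)
  moreover have "vector_derivative (\<lambda>_. 0::real) (at 1 within {0..1}) = 0"
    by (rule vector_derivative_within_closed_interval) auto
  ultimately show False
    by (simp add: LIMSEQ_const_iff)
qed

text \<open>Column vectors \<open>col(\<dots>)\<close> are tuples; the product inner product then is the one of column
  vectors, and the standard basis vectors of the product type select the scalar entries.\<close>

definition W_I :: "(real^'q \<Rightarrow> real^'p) \<Rightarrow> real \<times> real \<times> (real^'q) \<Rightarrow>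
    real \<times> real \<times> real \<times> (real^'p) \<times> (real^'p)" where
  "W_I G = (\<lambda>(\<theta>1, \<theta>2, \<eta>).
     (\<theta>1, \<theta>2, \<theta>1 * \<theta>2, \<theta>1 *\<^sub>R G \<eta>, (\<theta>1 * \<theta>2) *\<^sub>R G \<eta>))"

lemma DIM_W_I: "DIM(real \<times> real \<times> real \<times> (real^'p) \<times> (real^'p)) = 3 + 2 * CARD('p)"
  by simp

definition trajectory ::
  "(real^'n \<Rightarrow> real^'m \<Rightarrow> real^'n) \<Rightarrow> (real^'n \<Rightarrow> real^'m \<Rightarrow> real^'p^'n) \<Rightarrow> (real^'q \<Rightarrow> real^'p) \<Rightarrow>
   real^'q \<Rightarrow> (real \<Rightarrow> real^'n) \<Rightarrow> (real \<Rightarrow> real^'m) \<Rightarrow> bool" where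
  "trajectory f1 f2 G \<eta> x u \<longleftrightarrow> continuous_on {0..} u \<and>
     (\<forall>t\<ge>0. (x has_vector_derivative (f1 (x t) (u t) + f2 (x t) (u t) *v G \<eta>)) (at t within {0..}))"

definition system_output ::
  "(real^'n \<Rightarrow> real^'m \<Rightarrow> real) \<Rightarrow> (real^'n \<Rightarrow> real^'m \<Rightarrow> real) \<Rightarrow> (real^'n \<Rightarrow> real^'m \<Rightarrow> real) \<Rightarrow>
   (real^'n \<Rightarrow> real) \<Rightarrow> real \<Rightarrow> real \<Rightarrow> real^'n \<Rightarrow> real^'m \<Rightarrow> real \<times> (real^'n)" where
  "system_output h1 h2 h3 h4 \<theta>1 \<theta>2 x u =
     (h1 x u + h2 x u * \<theta>2 + h3 x u * exp (h4 x * \<theta>1), x)"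

end

theory Submission
  imports Defs
begin

text \<open>
  Along a trajectory put \<open>z = (y\<^sub>1 - h\<^sub>1) / h\<^sub>3\<close> and \<open>r = h\<^sub>2 / h\<^sub>3\<close>, so that
  \<open>q = z - \<theta>\<^sub>2 r = exp (\<theta>\<^sub>1 h\<^sub>4)\<close>.  With \<open>\<alpha> = \<nabla>h\<^sub>4 \<bullet> f\<^sub>1\<close> and \<open>\<beta> = f\<^sub>2\<^sup>T \<nabla>h\<^sub>4\<close> the derivative of
  \<open>h\<^sub>4\<close> is \<open>\<alpha> + \<beta> \<bullet> G \<eta>\<close>, hence \<open>q' = \<theta>\<^sub>1 (z - \<theta>\<^sub>2 r) (\<alpha> + \<beta> \<bullet> G \<eta>)\<close>, which is linear in the
  entries of \<open>W_I\<close>.  Applying the stable filter \<open>1 / (s + 1)\<close> turns the left-hand side into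
  \<open>s / (s + 1)\<close> applied to \<open>z - \<theta>\<^sub>2 r\<close>, which needs no differentiation.  If the resulting regressor
  vanishes identically, then so does the filtered \<open>q (\<alpha> + \<beta> \<bullet> G \<eta>)\<close>; as \<open>q > 0\<close>, the derivative
  of \<open>h\<^sub>4\<close> vanishes and \<open>h\<^sub>4\<close> is constant.
\<close>

section \<open>First-order filters; \<open>lowpass\<close> convolves with \<open>exp (- t)\<close>,
  the impulse response of \<open>1 / (s + 1)\<close>\<close>

definition lowpass :: "(real \<Rightarrow> real) \<Rightarrow> real \<Rightarrow> real" where
  "lowpass v t = integral {0..t} (\<lambda>s. exp (- (t - s)) * v s)"

text \<open>The filter \<open>s / (s + 1)\<close>; the term \<open>exp (- t) * v 0\<close> accounts for the initial condition.\<close>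

definition highpass :: "(real \<Rightarrow> real) \<Rightarrow> real \<Rightarrow> real" where
  "highpass v t = v t - exp (- t) * v 0 - lowpass v t"

lemma lowpass_integrable:
  fixes v :: "real \<Rightarrow> real"
  assumes "continuous_on {0..} v"
  shows "(\<lambda>s. exp (- (t - s)) * v s) integrable_on {0..t}"
proof (rule integrable_continuous_real)
  have "continuous_on {0..t} v"
    by (rule continuous_on_subset[OF assms]) auto
  then show "continuous_on {0..t} (\<lambda>s. exp (- (t - s)) * v s)"
    by (intro continuous_intros)
qed

lemma lowpass_add:
  assumes "continuous_on {0..} v" "continuous_on {0..} w"
  shows "lowpass (\<lambda>s. v s + w s) t = lowpass v t + lowpass w t"
  unfolding lowpass_def distrib_left
  by (intro integral_add lowpass_integrable assms)

lemma lowpass_diff: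
  assumes "continuous_on {0..} v" "continuous_on {0..} w"
  shows "lowpass (\<lambda>s. v s - w s) t = lowpass v t - lowpass w t"
  unfolding lowpass_def right_diff_distrib
  by (intro integral_diff lowpass_integrable assms)

lemma lowpass_cmult: "lowpass (\<lambda>s. c * v s) t = c * lowpass v t"
  unfolding lowpass_def by (simp add: mult.left_commute)

lemma lowpass_sum:
  assumes "finite I" "\<And>i. i \<in> I \<Longrightarrow> continuous_on {0..} (v i)"
  shows "lowpass (\<lambda>s. \<Sum>i\<in>I. v i s) t = (\<Sum>i\<in>I. lowpass (v i) t)"
  unfolding lowpass_def sum_distrib_left
  by (intro integral_sum lowpass_integrable assms)

text \<open>Integration by parts: the kernel \<open>exp (- (t - s))\<close> is its own derivative in
  \<open>s\<close>, so filtering \<open>v'\<close> costs only boundary terms and the filtered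
  \<open>v\<close>. This is what avoids differentiating a signal.\<close>

lemma lowpass_derivative:
  assumes v: "\<And>s. 0 \<le> s \<Longrightarrow> (v has_real_derivative v' s) (at s within {0..})"
    and v': "continuous_on {0..} v'" and t: "0 \<le> t"
  shows "lowpass v' t = highpass v t"
proof -
  have cv: "continuous_on {0..} v"
    by (rule DERIV_continuous_on) (use v in auto)
  have "((\<lambda>s. exp (- (t - s)) * v' s + exp (- (t - s)) * v s) has_integral
      exp (- (t - t)) * v t - exp (- (t - 0)) * v 0) {0..t}"
  proof (rule fundamental_theorem_of_calculus[OF t])
    fix s assume s: "s \<in> {0..t}"
    then have "(v has_real_derivative v' s) (at s within {0..t})"
      by (intro DERIV_subset[OF v]) auto
    then have "((\<lambda>s. exp (- (t - s)) * v s) has_real_derivative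
        exp (- (t - s)) * v' s + exp (- (t - s)) * v s) (at s within {0..t})"
      by (auto intro!: derivative_eq_intros)
    then show "((\<lambda>s. exp (- (t - s)) * v s) has_vector_derivative
        exp (- (t - s)) * v' s + exp (- (t - s)) * v s) (at s within {0..t})"
      by (simp add: has_real_derivative_iff_has_vector_derivative)
  qed
  then have "lowpass v' t + lowpass v t = v t - exp (- t) * v 0"
    using integral_add[OF lowpass_integrable[OF v'] lowpass_integrable[OF cv], of t]
    unfolding lowpass_def by (simp add: integral_unique)
  then show ?thesis
    by (simp add: highpass_def)
qed

text \<open>The filter is injective on continuous signals: after the factor \<open>exp (- t)\<close>
  is pulled out, an integral with variable upper limit vanishes identically, and so does its
  derivative.\<close>

lemma lowpass_eq_0D:
  assumes v: "continuous_on {0..} v" and 0: "\<And>t. 0 \<le> t \<Longrightarrow> lowpass v t = 0" and t: "0 \<le> t"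
  shows "v t = 0"
proof -
  have int0: "integral {0..b} (\<lambda>s. exp s * v s) = 0" if "0 \<le> b" for b
  proof -
    have "lowpass v b = integral {0..b} (\<lambda>s. exp (- b) * (exp s * v s))"
      unfolding lowpass_def by (intro integral_cong) (simp add: exp_diff exp_minus field_simps)
    then show ?thesis
      using 0[OF that] by simp
  qed
  \<comment> \<open>Extending the interval beyond \<open>t\<close> keeps it nondegenerate even for
    \<open>t = 0\<close>, as uniqueness of the derivative requires.\<close>
  have "((\<lambda>b. integral {0..b} (\<lambda>s. exp s * v s)) has_vector_derivative exp t * v t)
      (at t within {0..t + 1})"
    by (rule integral_has_vector_derivative)
       (use t in \<open>auto intro!: continuous_intros continuous_on_subset[OF v]\<close>)
  then have "((\<lambda>b. 0) has_vector_derivative exp t * v t) (at t within {0..t + 1})"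
    by (rule has_vector_derivative_transform[rotated 2]) (use t int0 in auto)
  then have "exp t * v t = 0"
    using t by (intro vector_derivative_unique_within_closed_interval[of 0 "t + 1" t "\<lambda>_. 0"]) auto
  then show ?thesis
    by simp
qed

section \<open>Closure properties of on-line measurable operators\<close>

lemma online_measurable_diff:
  assumes "online_measurable S" "online_measurable S'"
  shows "online_measurable (\<lambda>w t. S w t - S' w t)"
  unfolding online_measurable_def
proof
  show "causal (\<lambda>w t. S w t - S' w t)"
    unfolding causal_def
  proof (intro allI impI)
    fix t :: real and w w' :: "real \<Rightarrow> 'a"
    assume "0 \<le> t" "continuous_on {0..} w" "continuous_on {0..} w'" "\<forall>s\<in>{0..t}. w s = w' s"
    then have "S w t = S w' t" "S' w t = S' w' t"
      using assms unfolding online_measurable_def causal_def by blast+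
    then show "S w t - S' w t = S w' t - S' w' t"
      by simp
  qed
  show "differentiation_free (\<lambda>w t. S w t - S' w t)"
    using assms unfolding online_measurable_def differentiation_free_def
    by (intro allI impI tendsto_diff) blast+
qed

lemma online_measurable_uminus:
  assumes "online_measurable S"
  shows "online_measurable (\<lambda>w t. - S w t)"
  using online_measurable_diff[OF online_measurable_static[of "\<lambda>_. 0"] assms] by simp

text \<open>Covers the initial-condition term of \<open>highpass\<close>: time \<open>0\<close> lies
  in every window \<open>{0..t}\<close>.\<close>

lemma online_measurable_initial:
  assumes "continuous_on UNIV g"
  shows "online_measurable (\<lambda>w t. c t * g (w 0))"
  unfolding online_measurable_def causal_def differentiation_free_def
proof (intro conjI allI impI)
  fix t :: real and W :: "nat \<Rightarrow> real \<Rightarrow> 'a" and w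
  assume "0 \<le> t" "uniform_limit {0..t} W w sequentially"
  then have "(\<lambda>k. W k 0) \<longlonglongrightarrow> w 0"
    by (intro tendsto_uniform_limitI[where S = "{0..t}"]) auto
  then show "(\<lambda>k. c t * g (W k 0)) \<longlonglongrightarrow> c t * g (w 0)"
    using assms continuous_on_tendsto_compose[of UNIV g] by (auto intro!: tendsto_mult_left)
qed auto

lemma online_measurable_lowpass:
  fixes g :: "'w::euclidean_space \<Rightarrow> real"
  assumes "continuous_on UNIV g"
  shows "online_measurable (\<lambda>w. lowpass (\<lambda>s. g (w s)))"
  using online_measurable_low_pass[OF assms, of 1] unfolding lowpass_def by simp

lemma online_measurable_highpass:
  fixes g :: "'w::euclidean_space \<Rightarrow> real"
  assumes "continuous_on UNIV g"
  shows "online_measurable (\<lambda>w. highpass (\<lambda>s. g (w s)))"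
  unfolding highpass_def
  by (intro online_measurable_diff online_measurable_static online_measurable_initial
      online_measurable_lowpass assms)

lemma smooth_imp_continuous_on: "smooth f \<Longrightarrow> continuous_on UNIV f"
  unfolding smooth_def using Ck.simps(1) by blast

text \<open>\<open>Ck\<close> gives continuity of the derivative only for each fixed direction.
  Linearity reduces all directions to the finitely many basis vectors, whose values assemble into a
  continuous gradient.\<close>

lemma smooth_gradient:
  fixes h :: "'a::euclidean_space \<Rightarrow> real"
  assumes "smooth h"
  obtains D where "continuous_on UNIV D" "\<And>x. (h has_derivative (\<lambda>v. D x \<bullet> v)) (at x)"
proof -
  have "Ck (Suc 0) h"
    using assms unfolding smooth_def by blast
  then obtain h' where h': "\<And>x. (h has_derivative h' x) (at x)"
    and c: "\<And>v. continuous_on UNIV (\<lambda>x. h' x v)"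
    by auto
  define D where "D x = (\<Sum>b\<in>Basis. h' x b *\<^sub>R b)" for x
  have "h' x v = D x \<bullet> v" for x v
  proof -
    interpret linear "h' x"
      using h'[of x] by (rule has_derivative_linear)
    have "h' x v = h' x (\<Sum>b\<in>Basis. (v \<bullet> b) *\<^sub>R b)"
      by (simp add: euclidean_representation)
    also have "\<dots> = D x \<bullet> v"
      by (simp add: sum scale D_def inner_sum_left) (simp add: inner_commute mult.commute)
    finally show ?thesis .
  qed
  then have "h' x = (\<lambda>v. D x \<bullet> v)" for x
    by auto
  moreover have "continuous_on UNIV D"
    unfolding D_def by (intro continuous_intros c)
  ultimately show ?thesis
    using that h' by metis
qed

text \<open>The last conjunct excludes the trivial choice of zero \<open>Y\<close> and zero
  \<open>\<phi>\<close>: the regressor must be nonzero at some time whenever \<open>h4\<close>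
  varies along the trajectory.\<close>

theorem lemma1:
  fixes f1 :: "real^'n \<Rightarrow> real^'m \<Rightarrow> real^'n"
    and f2 :: "real^'n \<Rightarrow> real^'m \<Rightarrow> real^'p^'n"
    and h1 h2 h3 :: "real^'n \<Rightarrow> real^'m \<Rightarrow> real"
    and h4 :: "real^'n \<Rightarrow> real"
    and G :: "real^'q \<Rightarrow> real^'p"
  assumes "smooth (\<lambda>(x, u). f1 x u)" and "smooth (\<lambda>(x, u). f2 x u)"
    and "smooth (\<lambda>(x, u). h1 x u)" and "smooth (\<lambda>(x, u). h2 x u)"
    and "smooth (\<lambda>(x, u). h3 x u)" and "smooth h4" and "smooth G"
    and "CARD('p) > CARD('q)"
    and "\<forall>x u. \<bar>h3 x u\<bar> > 0"
    and "\<exists>(T :: real^'p^'q) \<rho>. \<rho> > 0 \<and>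
           (\<forall>\<eta>. sym_matrix_ge
                  (T ** jacobian G (at \<eta>) + transpose (jacobian G (at \<eta>)) ** transpose T)
                  (\<rho> *\<^sub>R mat 1))"
  shows "\<exists>(Y :: (real \<Rightarrow> (real^'n) \<times> (real^'m) \<times> (real \<times> (real^'n))) \<Rightarrow> real \<Rightarrow> real)
          (\<phi> :: (real \<Rightarrow> (real^'n) \<times> (real^'m) \<times> (real \<times> (real^'n))) \<Rightarrow> real \<Rightarrow>
                  real \<times> real \<times> real \<times> (real^'p) \<times> (real^'p)).
     online_measurable Y \<and> (\<forall>b\<in>Basis. online_measurable (\<lambda>w t. \<phi> w t \<bullet> b)) \<and>
     (\<forall>\<theta>1 \<theta>2 \<eta> x u y.
        trajectory f1 f2 G \<eta> x u \<longrightarrow> bounded (x ` {0..}) \<longrightarrow>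
        (\<forall>t\<ge>0. y t = system_output h1 h2 h3 h4 \<theta>1 \<theta>2 (x t) (u t)) \<longrightarrow>
        (let w = (\<lambda>t. (x t, u t, y t)) in
          (\<forall>t\<ge>0. Y w t = \<phi> w t \<bullet> W_I G (\<theta>1, \<theta>2, \<eta>)) \<and>
          ((\<exists>t\<ge>0. h4 (x t) \<noteq> h4 (x 0)) \<longrightarrow> (\<exists>t\<ge>0. \<phi> w t \<noteq> 0))))"
proof -
  note c = assms(1-5)[THEN smooth_imp_continuous_on]
  obtain D where cD: "continuous_on UNIV D"
    and D: "\<And>x. (h4 has_derivative (\<lambda>v. D x \<bullet> v)) (at x)"
    using smooth_gradient[OF assms(6)] by blast
  have h3: "h3 x u \<noteq> 0" for x u
    using assms(9) by force

  define z where "z w = (fst (snd (snd w)) - h1 (fst w) (fst (snd w))) / h3 (fst w) (fst (snd w))"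
    for w :: "(real^'n) \<times> (real^'m) \<times> (real \<times> (real^'n))"
  define r where "r w = h2 (fst w) (fst (snd w)) / h3 (fst w) (fst (snd w))"
    for w :: "(real^'n) \<times> (real^'m) \<times> (real \<times> (real^'n))"
  define \<alpha> where "\<alpha> w = D (fst w) \<bullet> f1 (fst w) (fst (snd w))"
    for w :: "(real^'n) \<times> (real^'m) \<times> (real \<times> (real^'n))"
  define \<beta> where "\<beta> i w = (\<Sum>j\<in>UNIV. D (fst w) $ j * f2 (fst w) (fst (snd w)) $ j $ i)"
    for i and w :: "(real^'n) \<times> (real^'m) \<times> (real \<times> (real^'n))"

  have c': "continuous_on UNIV
      (\<lambda>w :: (real^'n) \<times> (real^'m) \<times> (real \<times> (real^'n)). f (fst w) (fst (snd w)))"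
    if "continuous_on UNIV (\<lambda>(x, u). f x u)" for f :: "real^'n \<Rightarrow> real^'m \<Rightarrow> 'b::real_normed_vector"
  proof -
    have "continuous_on UNIV
        (\<lambda>w :: (real^'n) \<times> (real^'m) \<times> (real \<times> (real^'n)). (fst w, fst (snd w)))"
      by (intro continuous_intros)
    from continuous_on_compose2[OF that this] show ?thesis
      by simp
  qed
  have cD': "continuous_on UNIV
      (\<lambda>w :: (real^'n) \<times> (real^'m) \<times> (real \<times> (real^'n)). D (fst w))"
    by (rule continuous_on_compose2[OF cD]) (auto intro!: continuous_intros)
  have cont: "continuous_on UNIV z" "continuous_on UNIV r" "continuous_on UNIV \<alpha>"
    "\<And>i. continuous_on UNIV (\<beta> i)"
    unfolding z_def r_def \<alpha>_def \<beta>_def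
    by (intro continuous_intros c[THEN c'] cD'; use h3 in simp)+

  define Y where "Y w = highpass (\<lambda>s. z (w s))"
    for w :: "real \<Rightarrow> (real^'n) \<times> (real^'m) \<times> (real \<times> (real^'n))"
  \<comment> \<open>The blocks follow the order of \<open>W_I\<close>. They are the coefficients
    obtained by expanding \<open>\<theta>1 * (z - \<theta>2 * r) * (\<alpha> + \<beta> \<bullet> G
    \<eta>)\<close>, filtering, and moving \<open>\<theta>2\<close> times the high-passed
    \<open>r\<close> to the right; hence the signs.\<close>
  define \<phi> :: "(real \<Rightarrow> (real^'n) \<times> (real^'m) \<times> (real \<times> (real^'n))) \<Rightarrow> real \<Rightarrow>
      real \<times> real \<times> real \<times> (real^'p) \<times> (real^'p)"
    where "\<phi> w t =
      (lowpass (\<lambda>s. z (w s) * \<alpha> (w s)) t,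
       highpass (\<lambda>s. r (w s)) t,
       - lowpass (\<lambda>s. r (w s) * \<alpha> (w s)) t,
       (\<chi> i. lowpass (\<lambda>s. z (w s) * \<beta> i (w s)) t),
       (\<chi> i. - lowpass (\<lambda>s. r (w s) * \<beta> i (w s)) t))" for w t

  have "online_measurable Y"
    unfolding Y_def by (intro online_measurable_highpass cont)
  moreover have "online_measurable (\<lambda>w t. \<phi> w t \<bullet> b)" if "b \<in> Basis" for b
  proof -
    have m: "online_measurable (\<lambda>w. lowpass (\<lambda>s. z (w s) * \<alpha> (w s)))"
      "online_measurable (\<lambda>w. highpass (\<lambda>s. r (w s)))"
      "online_measurable (\<lambda>w t. - lowpass (\<lambda>s. r (w s) * \<alpha> (w s)) t)"
      "\<And>i. online_measurable (\<lambda>w. lowpass (\<lambda>s. z (w s) * \<beta> i (w s)))"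
      "\<And>i. online_measurable (\<lambda>w t. - lowpass (\<lambda>s. r (w s) * \<beta> i (w s)) t)"
      by (intro online_measurable_uminus online_measurable_lowpass online_measurable_highpass
          continuous_on_mult cont)+
    show ?thesis
      using that unfolding Basis_prod_def \<phi>_def
      by (auto simp: Basis_vec_def inner_axis m)
  qed
  moreover have "(\<forall>t\<ge>0. Y w t = \<phi> w t \<bullet> W_I G (\<theta>1, \<theta>2, \<eta>)) \<and>
      ((\<exists>t\<ge>0. h4 (x t) \<noteq> h4 (x 0)) \<longrightarrow> (\<exists>t\<ge>0. \<phi> w t \<noteq> 0))"
    if traj: "trajectory f1 f2 G \<eta> x u"
      and y: "\<forall>t\<ge>0. y t = system_output h1 h2 h3 h4 \<theta>1 \<theta>2 (x t) (u t)"
      and w: "w = (\<lambda>t. (x t, u t, y t))" for \<theta>1 \<theta>2 \<eta> x u y w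
  proof -
    \<comment> \<open>\<open>p\<close> and \<open>q\<close> contain the unknown parameters and serve
      the analysis only; \<open>p\<close> is the derivative of \<open>h4\<close> along the
      trajectory.\<close>
    define p where "p t = \<alpha> (w t) + (\<Sum>i\<in>UNIV. G \<eta> $ i * \<beta> i (w t))" for t
    define q where "q t = z (w t) - \<theta>2 * r (w t)" for t
    have cu: "continuous_on {0..} u"
      and x': "\<And>t. 0 \<le> t \<Longrightarrow>
        (x has_vector_derivative (f1 (x t) (u t) + f2 (x t) (u t) *v G \<eta>)) (at t within {0..})"
      using traj unfolding trajectory_def by auto
    have cx: "continuous_on {0..} x"
      by (rule continuous_on_vector_derivative) (use x' in auto)
    have ch: "continuous_on {0..} (\<lambda>t. h (x t) (u t))"
      if "continuous_on UNIV (\<lambda>(x, u). h x u)" for h :: "real^'n \<Rightarrow> real^'m \<Rightarrow> real"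
      using continuous_on_compose2[OF that continuous_on_Pair[OF cx cu]] by simp
    have ch4: "continuous_on {0..} (\<lambda>t. h4 (x t))"
      by (rule continuous_on_compose2[OF smooth_imp_continuous_on[OF assms(6)] cx]) auto
    \<comment> \<open>Continuity of \<open>y\<close> comes from the output formula, which holds for
      nonnegative times; the filter lemmas need it.\<close>
    have "continuous_on {0..} (\<lambda>t. system_output h1 h2 h3 h4 \<theta>1 \<theta>2 (x t) (u t))"
      unfolding system_output_def by (intro continuous_intros ch ch4 cx c)
    then have "continuous_on {0..} y"
      by (rule continuous_on_eq) (use y in auto)
    then have cw: "continuous_on {0..} w"
      unfolding w by (intro continuous_intros cx cu)
    have cs: "continuous_on {0..} (\<lambda>t. z (w t))" "continuous_on {0..} (\<lambda>t. r (w t))"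
      "continuous_on {0..} (\<lambda>t. \<alpha> (w t))" "\<And>i. continuous_on {0..} (\<lambda>t. \<beta> i (w t))"
      by (auto intro!: cont[THEN continuous_on_compose2, OF cw])
    have cp: "continuous_on {0..} p" and cq: "continuous_on {0..} q"
      unfolding p_def q_def by (intro continuous_intros cs)+

    have q: "q t = exp (h4 (x t) * \<theta>1)" if "0 \<le> t" for t
      using y that h3 unfolding q_def z_def r_def w by (simp add: system_output_def field_simps)
    have dh4: "((\<lambda>t. h4 (x t)) has_real_derivative p t) (at t within {0..})" if "0 \<le> t" for t
    proof -
      have "((\<lambda>t. h4 (x t)) has_vector_derivative
          D (x t) \<bullet> (f1 (x t) (u t) + f2 (x t) (u t) *v G \<eta>)) (at t within {0..})"
        using vector_derivative_diff_chain_within[OF x'[OF that] has_derivative_at_withinI[OF D]]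
        by (simp add: o_def)
      moreover have "D (x t) \<bullet> (f2 (x t) (u t) *v G \<eta>) = (\<Sum>i\<in>UNIV. G \<eta> $ i * \<beta> i (w t))"
        unfolding \<beta>_def w inner_vec_def matrix_vector_mult_def
        by (simp add: sum_distrib_left mult_ac) (rule sum.swap)
      ultimately show ?thesis
        by (simp add: has_real_derivative_iff_has_vector_derivative p_def \<alpha>_def w inner_add_right)
    qed
    have dq: "(q has_real_derivative \<theta>1 * (q t * p t)) (at t within {0..})" if "0 \<le> t" for t
    proof -
      have "((\<lambda>t. exp (h4 (x t) * \<theta>1)) has_real_derivative \<theta>1 * (q t * p t)) (at t within {0..})"
        using dh4[OF that] q[OF that] by (auto intro!: derivative_eq_intros)
      \<comment> \<open>\<open>q\<close> agrees with the exponential only on \<open>{0..}\<close>,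
        so the derivative is transferred within that set; the radius \<open>1\<close> is
        arbitrary.\<close>
      then show ?thesis
        by (rule has_field_derivative_transform_within[OF _ zero_less_one]) (use that q in auto)
    qed
    have high: "highpass q t = \<theta>1 * lowpass (\<lambda>s. q s * p s) t" if "0 \<le> t" for t
      using lowpass_derivative[OF dq _ that] cp cq
      by (simp add: lowpass_cmult continuous_on_mult)
    have highq: "highpass q t = Y w t - \<theta>2 * highpass (\<lambda>s. r (w s)) t" for t
      unfolding q_def Y_def highpass_def
      by (simp add: lowpass_diff lowpass_cmult cs continuous_intros algebra_simps)
    \<comment> \<open>The parameters are constant in time, so linearity of the filter pulls them out
      and leaves only filtered measured signals.\<close>
    have low: "lowpass (\<lambda>s. q s * p s) t =
        lowpass (\<lambda>s. z (w s) * \<alpha> (w s)) t - \<theta>2 * lowpass (\<lambda>s. r (w s) * \<alpha> (w s)) t +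
        (\<Sum>i\<in>UNIV. G \<eta> $ i * lowpass (\<lambda>s. z (w s) * \<beta> i (w s)) t) -
        \<theta>2 * (\<Sum>i\<in>UNIV. G \<eta> $ i * lowpass (\<lambda>s. r (w s) * \<beta> i (w s)) t)" for t
    proof -
      have "(\<lambda>s. q s * p s) = (\<lambda>s. z (w s) * \<alpha> (w s) - \<theta>2 * (r (w s) * \<alpha> (w s)) +
          (\<Sum>i\<in>UNIV. G \<eta> $ i * (z (w s) * \<beta> i (w s))) -
          \<theta>2 * (\<Sum>i\<in>UNIV. G \<eta> $ i * (r (w s) * \<beta> i (w s))))"
        unfolding p_def q_def by (simp add: algebra_simps sum_distrib_left sum_subtractf)
      then show ?thesis
        by (simp add: lowpass_add lowpass_diff lowpass_sum lowpass_cmult cs continuous_intros)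
    qed
    have "Y w t = \<phi> w t \<bullet> W_I G (\<theta>1, \<theta>2, \<eta>)" if "0 \<le> t" for t
      using high[OF that] unfolding highq low \<phi>_def W_I_def
      by (simp add: inner_vec_def algebra_simps sum_distrib_left sum_negf)
    moreover have "\<exists>t\<ge>0. \<phi> w t \<noteq> 0" if "\<exists>t\<ge>0. h4 (x t) \<noteq> h4 (x 0)"
    proof (rule ccontr)
      assume "\<not> (\<exists>t\<ge>0. \<phi> w t \<noteq> 0)"
      \<comment> \<open>By \<open>low\<close>, this signal is a linear combination of the entries of
        \<open>\<phi>\<close> other than the second.\<close>
      then have "lowpass (\<lambda>s. q s * p s) t = 0" if "0 \<le> t" for t
        using that unfolding low \<phi>_def by (auto simp: zero_prod_def vec_eq_iff)
      then have "q t * p t = 0" if "0 \<le> t" for t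
        using that by (intro lowpass_eq_0D[of "\<lambda>s. q s * p s"] continuous_on_mult cp cq)
      then have "p t = 0" if "0 \<le> t" for t
        using q[OF that] that by (metis exp_not_eq_zero mult_eq_0_iff)
      then have "((\<lambda>t. h4 (x t)) has_real_derivative 0) (at t within {0..})" if "t \<in> {0..}" for t
        using dh4[of t] that by simp
      then have "\<exists>c. \<forall>t\<in>{0..}. h4 (x t) = c"
        by (intro has_field_derivative_zero_constant) auto
      with that show False
        by auto
    qed
    ultimately show ?thesis
      by blast
  qed
  ultimately show ?thesis
    unfolding Let_def by blast
qed

end
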